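(* Let $n>0$ and $m>0$ be natural numbers. 1. For real numbers $r,s\in[0,1]$ with $r+s=1$, $$r^n\cdot\sum_{0\leq j<m}\left(\!\binom{n}{j}\!\right)s^j+s^m\cdot\sum_{0\leq i<n}\left(\!\binom{m}{i}\!\right)r^i=1.$$ 2. For natural numbers $N\geq n$ and $M\geq m$, $$\sum_{0\leq j<m}\left(\!\binom{n}{j}\!\right)\binom{N-n+M-j}{N-n}+\sum_{0\leq i<n}\left(\!\binom{m}{i}\!\right)\binom{N-i+M-m}{M-m}=\binom{N+M}{N}.$$ 3. For natural numbers $N>0$ and $M>0$, $$n\cdot\left(\!\binom{N}{n}\!\right)\cdot\sum_{0\leq j<m}\frac{\left(\!\binom{M}{j}\!\right)}{\left(\!\binom{n+j}{N+M}\!\right)}+m\cdot\left(\!\binom{M}{m}\!\right)\cdot\sum_{0\leq i<n}\frac{\left(\!\binom{N}{i}\!\right)}{\left(\!\binom{i+m}{N+M}\!\right)}=N+M.$$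
   Context: For natural numbers $n\geq1$ and $m\geq0$ the multichoose coefficient is $\left(\!\binom{n}{m}\!\right)=\binom{n+m-1}{m}=\frac{(n+m-1)!}{m!\,(n-1)!}$. The convention $0^0=1$ is used. *)

theory Defs
  imports Complex_Main
begin

text \<open>Meant for \<open>n \<ge> 1\<close>, where the truncated subtraction is exact.\<close>

definition multichoose :: "nat \<Rightarrow> nat \<Rightarrow> nat"  (infix "multichoose" 64)
  where "n multichoose m = (n + m - 1) choose m"

end

theory Submission
  imports Defs
begin

text \<open>All three identities are conservation laws for monotone lattice paths. Mass \<open>w 0 0\<close> is
  spread from the origin so that each path reaching \<open>(i, j)\<close> carries weight \<open>w i j\<close>, where
  \<open>w i j = w (i + 1) j + w i (j + 1)\<close>. Every path leaves the rectangle \<open>[0, n) \<times> [0, m)\<close> exactly once: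
  at \<open>(n, j)\<close> by a horizontal last step, which \<open>n multichoose j\<close> paths do, or at \<open>(i, m)\<close> by a
  vertical last step, which \<open>m multichoose i\<close> paths do. Hence the exit weights add up to \<open>w 0 0\<close>.
  The three parts are the weights \<open>r\<^sup>i s\<^sup>j\<close> (independent steps), \<open>(N - i + M - j) choose (N - i)\<close>
  (completions to a path ending at \<open>(N, M)\<close>), and those of a Polya urn started with \<open>N\<close> and \<open>M\<close>
  balls, scaled by \<open>N + M\<close>.\<close>

lemma multichoose_0_right [simp]: "n multichoose 0 = 1"
  by (simp add: multichoose_def)

lemma multichoose_0_Suc [simp]: "0 multichoose Suc k = 0"
  by (simp add: multichoose_def)

lemma multichoose_Suc_Suc:
  "Suc m multichoose Suc k = (Suc m multichoose k) + (m multichoose Suc k)"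
  by (simp add: multichoose_def)

lemma multichoose_Suc_commute: "Suc n multichoose m = Suc m multichoose n"
  using binomial_symmetric[of m "n + m"] by (simp add: multichoose_def add.commute)

lemma of_nat_multichoose_Suc:
  "of_nat (Suc n multichoose m) = (fact (n + m) / (fact m * fact n) :: 'a :: field_char_0)"
  by (simp add: multichoose_def binomial_fact)

text \<open>Mass that enters row \<open>m\<close> leaves it through the top or, past column
  \<open>k\<close>, on the right. Either way it leaves from some \<open>(i, m)\<close>, a point
  reached by \<open>Suc m multichoose i\<close> paths.\<close>

lemma multichoose_row_exchange:
  fixes w :: "nat \<Rightarrow> nat \<Rightarrow> 'a :: comm_semiring_1"
  assumes "\<And>i. i \<le> k \<Longrightarrow> w i m = w (Suc i) m + w i (Suc m)"
  shows "(\<Sum>i\<le>k. of_nat (Suc m multichoose i) * w i (Suc m))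
           + of_nat (Suc m multichoose k) * w (Suc k) m
         = (\<Sum>i\<le>k. of_nat (m multichoose i) * w i m)"
  using assms
proof (induction k)
  case 0
  then show ?case by (simp add: add.commute)
next
  case (Suc k)
  have "(\<Sum>i\<le>Suc k. of_nat (m multichoose i) * w i m)
      = (\<Sum>i\<le>k. of_nat (Suc m multichoose i) * w i (Suc m))
          + of_nat (Suc m multichoose Suc k) * w (Suc k) m"
    using Suc by (simp add: multichoose_Suc_Suc algebra_simps)
  also have "w (Suc k) m = w (Suc (Suc k)) m + w (Suc k) (Suc m)"
    using Suc.prems by blast
  finally show ?case by (simp add: algebra_simps)
qed

lemma multichoose_exit_sum:
  fixes w :: "nat \<Rightarrow> nat \<Rightarrow> 'a :: comm_semiring_1"
  assumes "n > 0"
    and "\<And>i j. i < n \<Longrightarrow> j < m \<Longrightarrow> w i j = w (Suc i) j + w i (Suc j)"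
  shows "(\<Sum>j<m. of_nat (n multichoose j) * w n j)
           + (\<Sum>i<n. of_nat (m multichoose i) * w i m) = w 0 0"
  using assms(2)
proof (induction m)
  case 0
  \<comment> \<open>At height 0 the origin is the only exit: truncated subtraction makes
    \<open>0 multichoose i\<close> equal to 1 for \<open>i = 0\<close> and to 0 otherwise.\<close>
  show ?case using \<open>n > 0\<close>
    by (cases n) (simp_all add: lessThan_Suc_atMost sum.atMost_shift)
next
  case (Suc m)
  obtain k where n: "n = Suc k" using \<open>n > 0\<close> gr0_implies_Suc by blast
  \<comment> \<open>Adding row \<open>m\<close> to the rectangle trades the old top exits for new
    ones and the exit \<open>(n, m)\<close>.\<close>
  have "of_nat (n multichoose m) * w n m
           + (\<Sum>i<n. of_nat (Suc m multichoose i) * w i (Suc m))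
         = (\<Sum>i<n. of_nat (m multichoose i) * w i m)"
    using multichoose_row_exchange[of k w m] Suc.prems
    unfolding n lessThan_Suc_atMost multichoose_Suc_commute[of k]
    by (simp only: le_imp_less_Suc lessI add.commute)
  moreover have "(\<Sum>j<m. of_nat (n multichoose j) * w n j)
           + (\<Sum>i<n. of_nat (m multichoose i) * w i m) = w 0 0"
    by (intro Suc.IH Suc.prems) simp_all
  ultimately show ?case by (simp add: add.assoc)
qed

text \<open>A path from \<open>(i, j)\<close> to \<open>(N, M)\<close> starts with a horizontal or a
  vertical step; the strict bounds leave room for both.\<close>

lemma binomial_Pascal_diff:
  fixes i j M N :: nat
  assumes "i < N" and "j < M"
  shows "(N - i + M - j) choose (N - i)
         = ((N - Suc i + M - j) choose (N - Suc i)) + ((N - i + M - Suc j) choose (N - i))"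
proof -
  obtain a b where "N = Suc (i + a)" "M = Suc (j + b)"
    using assms less_iff_Suc_add by metis
  then show ?thesis by simp
qed

text \<open>The urn starts with \<open>N = a + 1\<close> and \<open>M = b + 1\<close> balls, which avoids truncated subtraction.\<close>

definition polya_weight :: "nat \<Rightarrow> nat \<Rightarrow> nat \<Rightarrow> nat \<Rightarrow> real" where
  "polya_weight a b i j = fact (a + i) * fact (b + j) * fact (a + b + 2)
     / (fact a * fact b * fact (a + b + i + j + 1))"

lemma polya_weight_0_0: "polya_weight a b 0 0 = real (a + b + 2)"
  by (simp add: polya_weight_def divide_simps)

lemma polya_weight_commute: "polya_weight a b i j = polya_weight b a j i"
  by (simp add: polya_weight_def add_ac mult_ac)

text \<open>The summands are the fractions \<open>(a + i + 1) / (a + b + i + j + 2)\<close> and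
  \<open>(b + j + 1) / (a + b + i + j + 2)\<close> of the left side, the chances of the two colours
  after \<open>i + j\<close> draws.\<close>

lemma polya_weight_rec:
  "polya_weight a b i j = polya_weight a b (Suc i) j + polya_weight a b i (Suc j)"
proof -
  define F :: real where "F = fact (a + b + i + j + 1)"
  have F: "F > 0" "fact (a + b + i + j + 2) = real (a + b + i + j + 2) * F"
    by (simp_all add: F_def)
  have s: "fact (a + Suc i) = real (a + i + 1) * fact (a + i)"
          "fact (b + Suc j) = real (b + j + 1) * fact (b + j)" by simp_all
  have e: "a + b + Suc i + j + 1 = a + b + i + j + 2"
          "a + b + i + Suc j + 1 = a + b + i + j + 2" by simp_all
  show ?thesis
    unfolding polya_weight_def s e F(2) F_def[symmetric]
    using F(1) by (simp add: divide_simps) (simp add: algebra_simps)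
qed

text \<open>The factor \<open>n\<close> turns \<open>fact n\<close> into \<open>fact (n - 1)\<close>
  and the reciprocal supplies \<open>fact (n + j - 1)\<close>; with \<open>fact j\<close> these make
  up \<open>n multichoose j\<close>.\<close>

lemma multichoose_polya_weight:
  assumes "n > 0"
  shows "real n * real (Suc a multichoose n) * (real (Suc b multichoose j)
           / real ((n + j) multichoose (a + b + 2)))
         = real (n multichoose j) * polya_weight a b n j"
proof -
  obtain p where n: "n = Suc p" using assms gr0_implies_Suc by blast
  have e: "n + j = Suc (p + j)" "p + j + (a + b + 2) = a + b + n + j + 1"
    by (simp_all add: n)
  have "real n * real (Suc a multichoose n) = fact (a + n) / (fact p * fact a)"
    by (simp add: n of_nat_multichoose_Suc divide_simps del: fact_Suc add_Suc_right) simp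
  moreover have "real (n multichoose j) = fact (p + j) / (fact j * fact p)"
    by (simp add: n of_nat_multichoose_Suc)
  moreover have "real ((n + j) multichoose (a + b + 2))
      = fact (a + b + n + j + 1) / (fact (a + b + 2) * fact (p + j))"
    unfolding e(1) of_nat_multichoose_Suc e(2) ..
  ultimately show ?thesis
    unfolding polya_weight_def of_nat_multichoose_Suc by (simp add: mult_ac del: fact_Suc)
qed

theorem corollary15:
  fixes n m :: nat
  assumes "n > 0" and "m > 0"
  shows "(\<forall>r s :: real. r \<in> {0..1} \<longrightarrow> s \<in> {0..1} \<longrightarrow> r + s = 1 \<longrightarrow>
           r ^ n * (\<Sum>j<m. real (n multichoose j) * s ^ j)
           + s ^ m * (\<Sum>i<n. real (m multichoose i) * r ^ i) = 1)
    \<and> (\<forall>N M :: nat. N \<ge> n \<longrightarrow> M \<ge> m \<longrightarrow>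
           (\<Sum>j<m. (n multichoose j) * ((N - n + M - j) choose (N - n)))
           + (\<Sum>i<n. (m multichoose i) * ((N - i + M - m) choose (M - m)))
           = (N + M) choose N)
    \<and> (\<forall>N M :: nat. N > 0 \<longrightarrow> M > 0 \<longrightarrow>
           real n * real (N multichoose n)
             * (\<Sum>j<m. real (M multichoose j) / real ((n + j) multichoose (N + M)))
           + real m * real (M multichoose m)
             * (\<Sum>i<n. real (N multichoose i) / real ((i + m) multichoose (N + M)))
           = real (N + M))"
proof (intro conjI allI impI)
  fix r s :: real
  assume "r + s = 1"
  moreover have "r ^ Suc i * s ^ j + r ^ i * s ^ Suc j = (r + s) * (r ^ i * s ^ j)" for i j
    by (simp add: algebra_simps)
  ultimately have "r ^ i * s ^ j = r ^ Suc i * s ^ j + r ^ i * s ^ Suc j" for i j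
    by (simp only: mult_1)
  from multichoose_exit_sum[of n m "\<lambda>i j. r ^ i * s ^ j", OF assms(1) this]
  show "r ^ n * (\<Sum>j<m. real (n multichoose j) * s ^ j)
      + s ^ m * (\<Sum>i<n. real (m multichoose i) * r ^ i) = 1"
    by (simp add: sum_distrib_left mult_ac)
next
  fix N M :: nat
  assume "N \<ge> n" and "M \<ge> m"
  then have "(N - i + M - j) choose (N - i)
      = ((N - Suc i + M - j) choose (N - Suc i)) + ((N - i + M - Suc j) choose (N - i))"
    if "i < n" "j < m" for i j
    using that by (intro binomial_Pascal_diff) simp_all
  from multichoose_exit_sum[of n m "\<lambda>i j. (N - i + M - j) choose (N - i)", OF assms(1) this]
  have "(\<Sum>j<m. (n multichoose j) * ((N - n + M - j) choose (N - n)))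
      + (\<Sum>i<n. (m multichoose i) * ((N - i + M - m) choose (N - i))) = (N + M) choose N"
    by simp
  \<comment> \<open>The completion count comes with lower index \<open>N - i\<close>; symmetry gives
    the stated \<open>M - m\<close>.\<close>
  moreover have "(N - i + M - m) choose (N - i) = (N - i + M - m) choose (M - m)" for i
    using \<open>M \<ge> m\<close> binomial_symmetric[of "N - i" "N - i + M - m"] by simp
  ultimately show "(\<Sum>j<m. (n multichoose j) * ((N - n + M - j) choose (N - n)))
      + (\<Sum>i<n. (m multichoose i) * ((N - i + M - m) choose (M - m)))
      = (N + M) choose N"
    by simp
next
  fix N M :: nat
  assume "N > 0" and "M > 0"
  then obtain a b where N: "N = Suc a" and M: "M = Suc b"
    using gr0_implies_Suc by metis
  have NM: "N + M = a + b + 2" "N + M = b + a + 2" by (simp_all add: N M)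
  have "real n * real (N multichoose n)
      * (\<Sum>j<m. real (M multichoose j) / real ((n + j) multichoose (N + M)))
      = (\<Sum>j<m. real (n multichoose j) * polya_weight a b n j)"
    unfolding sum_distrib_left NM(1) unfolding N M
    using assms(1) by (simp only: multichoose_polya_weight)
  \<comment> \<open>Exchanging the two colours, and with them the axes, makes vertical exits
    horizontal.\<close>
  moreover have "real m * real (M multichoose m)
      * (\<Sum>i<n. real (N multichoose i) / real ((i + m) multichoose (N + M)))
      = (\<Sum>i<n. real (m multichoose i) * polya_weight a b i m)"
    unfolding sum_distrib_left NM(2) add.commute[of _ m] polya_weight_commute[of a] unfolding N M
    using assms(2) by (simp only: multichoose_polya_weight)
  ultimately show "real n * real (N multichoose n)
      * (\<Sum>j<m. real (M multichoose j) / real ((n + j) multichoose (N + M)))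
      + real m * real (M multichoose m)
      * (\<Sum>i<n. real (N multichoose i) / real ((i + m) multichoose (N + M)))
      = real (N + M)"
    using multichoose_exit_sum[of n m "polya_weight a b", OF assms(1) polya_weight_rec]
    by (simp add: polya_weight_0_0 NM(1))
qed

end
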